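(* Let $\mathcal K$ be an oriented link type in $S^3$ with braid index $b_{\mathcal K}$, and let $K$ be a closed braid representative of $\mathcal K$ with $b_K=b_{\mathcal K}$. Focus on one site of $K$ and construct the closed braids $K_+,K_-,K_0$ associated with this site, so that one of the three is $K$. Let $\alpha,\beta,\gamma\in\{+,-,0\}$ be mutually distinct with $K_\alpha=K$, and let $p,n\ge 0$ be integers. (1) If positive destabilization is applicable $p$ times to each of $K_\beta$ and $K_\gamma$, then $D_K^+\ge 2p$. (2) If negative destabilization is applicable $n$ times to each of $K_\beta$ and $K_\gamma$, then $D_K^-\ge 2n$. Therefore, if the hypotheses of (1) and (2) hold with $p+n>0$, the Morton--Franks--Williams inequality is not sharp on $\mathcal K$, i.e. $D_{\mathcal K}>0$.
   Context: For a closed braid $K$, $b_K$ is its number of strands and $c_K$ its algebraic crossing number (writhe, i.e. exponent sum of the braid word in the standard generators $\sigma_i$). The braid index $b_{\mathcal K}$ of a link type is the least number of strands of a closed braid representing it. The HOMFLYPT polynomial $P_K(v,z)$ is the Laurent polynomial invariant of oriented links with $\frac1v P_{K_+}-vP_{K_-}=zP_{K_0}$ and $P_{\mathrm{unknot}}=1$, where $K_+,K_-,K_0$ are identical except at one place where they have, respectively, a positive crossing, a negative crossing, and the orientation-respecting resolution. Let $d_+$, $d_-$ be the maximal and minimal degrees of $v$ in $P_{\mathcal K}$. The Morton--Franks--Williams (MFW) inequality says $c_K-b_K+1\le d_-\le d_+\le c_K+b_K-1$ for every closed braid representative $K$ of $\mathcal K$, hence $\frac12(d_+-d_-)+1\le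 b_{\mathcal K}$. The deficit is $D_{\mathcal K}:=b_{\mathcal K}-\frac12(d_+-d_-)-1$, and the MFW inequality is sharp on $\mathcal K$ if $D_{\mathcal K}=0$. For a closed braid representative $K$: $D_K^+:=(c_K+b_K-1)-d_+$ and $D_K^-:=d_--(c_K-b_K+1)$. Site: $K$ is written as the closure of a braid word $u\sigma_i^{\varepsilon}w$ with $\varepsilon\in\{1,-1,0\}$; then $K_+,K_-,K_0$ are the closures (on the same number of strands) of $u\sigma_iw$, $u\sigma_i^{-1}w$, $uw$. A positive (resp. negative) destabilization replaces the closure of an $m$-braid $x\sigma_{m-1}$ (resp. $x\sigma_{m-1}^{-1}$) with $x\in B_{m-1}$ by the closure of the $(m-1)$-braid $x$. Positive (negative) destabilization is applicable $p$ times to a closed braid if there is a sequence of braid isotopies (conjugations), exchange moves and destabilizations starting from it that contains at least $p$ positive (negative) destabilizations. (Exchange move: replace the closure of an $m$-braid $X\sigma_{m-1}Y\sigma_{m-1}^{-1}$ by that of $X\sigma_{m-1}^{-1}Y\sigma_{m-1}$, where $X\in B_{m-1}$ and $Y$ is a word in $\sigma_2,\dots,\sigma_{m-1}$ for which this move preserves the link type, e.g. $X\in\langle\sigma_1,\dots,\sigma_{m-2}\rangle$ and $Y\in\langle\sigma_1,\dots,\sigma_{m-3}\rangle$ up to conjugation; it preserves $b_K$, $c_K$ and the link type.) *)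

theory Defs
  imports "HOL-Library.Poly_Mapping" "HOL-Library.Product_Plus" Complex_Main
begin

section \<open>Oriented links\<close>

text \<open>
  An oriented link is presented by a diagram in general position with respect to the height
  function of the plane, read from bottom to top as a sequence of elementary events. A level of the
  diagram is the list of orientations of the strands met there, from left to right
  (\<^term>\<open>True\<close>: upwards, \<^term>\<open>False\<close>: downwards). An event \<^term>\<open>(i, e)\<close> happens at
  the strands in positions \<^term>\<open>i\<close>, \<^term>\<open>i + 1\<close>, counted from 0:
  \<^item> \<open>Cup d\<close>: a local minimum creates these two strands, oriented \<^term>\<open>d\<close> and \<^term>\<open>\<not> d\<close>;
  \<^item> \<open>Cap\<close>: a local maximum joins them;
  \<^item> \<open>Cross s\<close>: they cross; the strand rising from left to right passes over the other
    one if and only if \<^term>\<open>s\<close>.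
\<close>

datatype event = Cup bool | Cap | Cross bool

type_synonym diagram = "(nat \<times> event) list"

fun step :: "nat \<times> event \<Rightarrow> bool list \<Rightarrow> bool list option" where
  "step (i, Cup d) st =
     (if i \<le> length st then Some (take i st @ [d, \<not> d] @ drop i st) else None)"
| "step (i, Cap) st =
     (if i + 1 < length st \<and> st ! i \<noteq> st ! (i + 1)
      then Some (take i st @ drop (i + 2) st) else None)"
| "step (i, Cross s) st =
     (if i + 1 < length st
      then Some (take i st @ [st ! (i + 1), st ! i] @ drop (i + 2) st) else None)"

fun run :: "diagram \<Rightarrow> bool list \<Rightarrow> bool list option" where
  "run [] st = Some st"
| "run (x # D) st = Option.bind (step x st) (run D)"

text \<open>Links are nonempty (the skein relation says nothing about the empty link).\<close>

definition link_diagram :: "diagram \<Rightarrow> bool" where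
  "link_diagram D \<longleftrightarrow> D \<noteq> [] \<and> run D [] = Some []"

fun ins :: "event \<Rightarrow> nat" where
  "ins (Cup d) = 0" | "ins Cap = 2" | "ins (Cross s) = 2"

fun outs :: "event \<Rightarrow> nat" where
  "outs (Cup d) = 2" | "outs Cap = 0" | "outs (Cross s) = 2"

text \<open>
  The local moves are the planar isotopies of diagrams with a height function (exchanging the heights
  of two events lying side by side, cancelling a maximum against a minimum, and swinging a crossing
  past an extremum) and the three Reidemeister moves. In \<open>R3\<close> the three crossings must come from a
  linear order of the three strands, which is the side condition.
\<close>

inductive local_move :: "diagram \<Rightarrow> diagram \<Rightarrow> bool" where
  far: "local_move [(i, e), (i + outs e + k, f)] [(i + ins e + k, f), (i, e)]"
| zigzag1: "local_move [(i, Cup d), (i + 1, Cap)] []"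
| zigzag2: "local_move [(i + 1, Cup d), (i, Cap)] []"
| swing_cap: "local_move [(i + 1, Cross s), (i, Cap)] [(i, Cross (\<not> s)), (i + 1, Cap)]"
| swing_cup: "local_move [(i, Cup d), (i + 1, Cross s)] [(i + 1, Cup d), (i, Cross (\<not> s))]"
| R1_cap: "local_move [(i, Cross s), (i, Cap)] [(i, Cap)]"
| R1_cup: "local_move [(i, Cup d), (i, Cross s)] [(i, Cup (\<not> d))]"
| R2: "local_move [(i, Cross s), (i, Cross (\<not> s))] []"
| R3: "t = s \<or> t = u \<Longrightarrow>
       local_move [(i, Cross s), (i + 1, Cross t), (i, Cross u)]
                  [(i + 1, Cross u), (i, Cross t), (i + 1, Cross s)]"

definition in_context :: "('a list \<Rightarrow> 'a list \<Rightarrow> bool) \<Rightarrow> 'a list \<Rightarrow> 'a list \<Rightarrow> bool" where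
  "in_context R x y \<longleftrightarrow> (\<exists>A l r B. R l r \<and> x = A @ l @ B \<and> y = A @ r @ B)"

definition isotopic :: "diagram \<Rightarrow> diagram \<Rightarrow> bool" where
  "isotopic D D' \<longleftrightarrow> link_diagram D \<and>
     equivclp (\<lambda>x y. link_diagram x \<and> link_diagram y \<and> in_context local_move x y) D D'"

lemma link_diagram_equivclp:
  assumes "equivclp (\<lambda>x y. link_diagram x \<and> link_diagram y \<and> in_context R x y) D D'"
  shows "link_diagram D \<longleftrightarrow> link_diagram D'"
  using assms by (induction rule: equivclp_induct) auto

text \<open>The unknot diagram is the closure of the trivial 1-braid, see \<open>braid_closure\<close> below.\<close>

definition unknot :: diagram where
  "unknot = [(0, Cup True), (0, Cap)]"

text \<open>
  Oriented link types. By Reidemeister's theorem these are the isotopy classes of (tame) oriented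
  links in the 3-sphere. Only diagrams satisfying \<^const>\<open>link_diagram\<close> represent a link type.
\<close>

quotient_type link = diagram / partial: isotopic
  morphisms rep_link link_of
proof (rule part_equivpI)
  have "link_diagram unknot"
    by (simp add: link_diagram_def unknot_def)
  then have "isotopic unknot unknot"
    by (simp add: isotopic_def)
  then show "\<exists>D. isotopic D D" ..
  show "symp isotopic"
    unfolding isotopic_def by (rule sympI) (auto dest: link_diagram_equivclp intro: equivclp_sym)
  show "transp isotopic"
    unfolding isotopic_def by (rule transpI) (auto intro: equivclp_trans)
qed

section \<open>The HOMFLYPT polynomial\<close>

text \<open>
  The ring of integral Laurent polynomials in \<open>v\<close> and \<open>z\<close> is the group ring of the free abelian
  group of exponents: \<^term>\<open>Poly_Mapping.lookup p (a, b)\<close> is the coefficient of the monomial with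
  \<open>v\<close>-exponent \<^term>\<open>a\<close> and \<open>z\<close>-exponent \<^term>\<open>b\<close>.
\<close>

type_synonym laurent = "(int \<times> int) \<Rightarrow>\<^sub>0 int"

definition mono_vz :: "int \<Rightarrow> int \<Rightarrow> laurent" where
  "mono_vz a b = Poly_Mapping.single (a, b) 1"

text \<open>
  A skein triple: three link diagrams identical except at one crossing. If the two strands at the
  crossing are both oriented upwards or both downwards, then \<open>Cross True\<close> is positive and the resolution
  removes the crossing; if they are oriented oppositely, then \<open>Cross False\<close> is positive and the
  resolution consists of a maximum below a minimum.
\<close>

inductive skein_triple :: "diagram \<Rightarrow> diagram \<Rightarrow> diagram \<Rightarrow> bool" where
  parallel:
    "\<lbrakk>run A [] = Some st; i + 1 < length st; st ! i = st ! (i + 1);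
      link_diagram (A @ [(i, Cross True)] @ B)\<rbrakk> \<Longrightarrow>
     skein_triple (A @ [(i, Cross True)] @ B) (A @ [(i, Cross False)] @ B) (A @ B)"
| antiparallel:
    "\<lbrakk>run A [] = Some st; i + 1 < length st; st ! i \<noteq> st ! (i + 1);
      link_diagram (A @ [(i, Cross False)] @ B)\<rbrakk> \<Longrightarrow>
     skein_triple (A @ [(i, Cross False)] @ B) (A @ [(i, Cross True)] @ B)
                  (A @ [(i, Cap), (i, Cup (st ! (i + 1)))] @ B)"

definition is_homflypt :: "(link \<Rightarrow> laurent) \<Rightarrow> bool" where
  "is_homflypt P \<longleftrightarrow> P (link_of unknot) = 1 \<and>
     (\<forall>Dp Dm D0. skein_triple Dp Dm D0 \<longrightarrow>
        mono_vz (-1) 0 * P (link_of Dp) - mono_vz 1 0 * P (link_of Dm)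
          = mono_vz 0 1 * P (link_of D0))"

definition max_deg_v :: "laurent \<Rightarrow> int" where
  "max_deg_v p = Max (fst ` Poly_Mapping.keys p)"

definition min_deg_v :: "laurent \<Rightarrow> int" where
  "min_deg_v p = Min (fst ` Poly_Mapping.keys p)"

section \<open>Closed braids\<close>

text \<open>The letter \<^term>\<open>(i, True)\<close> stands for the generator \<open>\<sigma>\<^sub>i\<close> (with \<open>i\<close> counted from 1),
  and \<^term>\<open>(i, False)\<close> for its inverse.\<close>

type_synonym braid_word = "(nat \<times> bool) list"

definition braid_words :: "nat set \<Rightarrow> braid_word set" where
  "braid_words J = lists (J \<times> UNIV)"

definition inv_word :: "braid_word \<Rightarrow> braid_word" where
  "inv_word w = rev (map (\<lambda>(i, s). (i, \<not> s)) w)"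

inductive braid_relation :: "braid_word \<Rightarrow> braid_word \<Rightarrow> bool" where
  cancel: "braid_relation [(i, s), (i, \<not> s)] []"
| commute: "i + 1 < j \<Longrightarrow> braid_relation [(i, s), (j, t)] [(j, t), (i, s)]"
| braid: "braid_relation [(i, True), (i + 1, True), (i, True)]
                         [(i + 1, True), (i, True), (i + 1, True)]"

text \<open>Two words represent the same element of the braid group on \<^term>\<open>m\<close> strands.\<close>

definition braid_eq :: "nat \<Rightarrow> braid_word \<Rightarrow> braid_word \<Rightarrow> bool" where
  "braid_eq m =
     equivclp (\<lambda>x y. x \<in> braid_words {1..<m} \<and> y \<in> braid_words {1..<m} \<and>
                     in_context braid_relation x y)"

text \<open>A closed braid is given by its number of strands and a braid word.\<close>

type_synonym closed_braid = "nat \<times> braid_word"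

definition is_closed_braid :: "closed_braid \<Rightarrow> bool" where
  "is_closed_braid K \<longleftrightarrow> 1 \<le> fst K \<and> snd K \<in> braid_words {1..<fst K}"

abbreviation strands :: "closed_braid \<Rightarrow> nat" where
  "strands K \<equiv> fst K"

definition writhe :: "closed_braid \<Rightarrow> int" where
  "writhe K = (\<Sum>(i, s)\<leftarrow>snd K. if s then 1 else -1)"

text \<open>
  The closure: \<open>m\<close> nested minima create the \<open>m\<close> upward braid strands (positions \<open>0, \<dots>, m - 1\<close>) and the
  \<open>m\<close> downward return strands to their right, which are joined to the braid strands by nested maxima.
\<close>

definition braid_closure :: "closed_braid \<Rightarrow> diagram" where
  "braid_closure K =
     map (\<lambda>j. (j, Cup True)) [0..<strands K]
     @ map (\<lambda>(i, s). (i - 1, Cross s)) (snd K)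
     @ map (\<lambda>j. (j, Cap)) (rev [0..<strands K])"

definition link_type :: "closed_braid \<Rightarrow> link" where
  "link_type K = link_of (braid_closure K)"

definition braid_index :: "link \<Rightarrow> nat" where
  "braid_index L = (LEAST b. \<exists>K. is_closed_braid K \<and> strands K = b \<and> link_type K = L)"

subsection \<open>Sites\<close>

datatype site_sign = Plus | Minus | Zero

fun site_word :: "nat \<Rightarrow> site_sign \<Rightarrow> braid_word" where
  "site_word i Plus = [(i, True)]"
| "site_word i Minus = [(i, False)]"
| "site_word i Zero = []"

definition at_site :: "nat \<Rightarrow> braid_word \<Rightarrow> nat \<Rightarrow> braid_word \<Rightarrow> site_sign \<Rightarrow> closed_braid" where
  "at_site m u i w \<epsilon> = (m, u @ site_word i \<epsilon> @ w)"

subsection \<open>Conjugation, exchange moves, destabilization\<close>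

inductive braid_isotopy :: "closed_braid \<Rightarrow> closed_braid \<Rightarrow> bool" where
  "\<lbrakk>w \<in> braid_words {1..<m}; g \<in> braid_words {1..<m}; w' \<in> braid_words {1..<m};
    braid_eq m w' (g @ w @ inv_word g)\<rbrakk> \<Longrightarrow> braid_isotopy (m, w) (m, w')"

text \<open>
  The word \<open>Y\<close> may be either in \<open>\<sigma>\<^sub>2, \<dots>, \<sigma>\<^sub>m\<^sub>-\<^sub>1\<close> or in \<open>\<sigma>\<^sub>1, \<dots>, \<sigma>\<^sub>m\<^sub>-\<^sub>2\<close> (the latter being the usual
  form of an exchange move); in either case preservation of the link type is demanded. The sign
  \<^term>\<open>s\<close> makes the move reversible.
\<close>

inductive exchange_move :: "closed_braid \<Rightarrow> closed_braid \<Rightarrow> bool" where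
  "\<lbrakk>2 \<le> m; X \<in> braid_words {1..<m - 1};
    Y \<in> braid_words {2..<m} \<union> braid_words {1..<m - 1};
    link_type (m, X @ [(m - 1, s)] @ Y @ [(m - 1, \<not> s)])
      = link_type (m, X @ [(m - 1, \<not> s)] @ Y @ [(m - 1, s)])\<rbrakk> \<Longrightarrow>
   exchange_move (m, X @ [(m - 1, s)] @ Y @ [(m - 1, \<not> s)])
                 (m, X @ [(m - 1, \<not> s)] @ Y @ [(m - 1, s)])"

text \<open>Positive (\<open>s = True\<close>) and negative (\<open>s = False\<close>) destabilization.\<close>

inductive destabilization :: "bool \<Rightarrow> closed_braid \<Rightarrow> closed_braid \<Rightarrow> bool" where
  "\<lbrakk>2 \<le> m; x \<in> braid_words {1..<m - 1}\<rbrakk> \<Longrightarrow>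
   destabilization s (m, x @ [(m - 1, s)]) (m - 1, x)"

text \<open>\<open>destab_sequence s q K K'\<close>: a sequence of moves leads from \<open>K\<close> to \<open>K'\<close> and contains exactly
  \<open>q\<close> destabilizations of sign \<open>s\<close>; those of the opposite sign may occur but are not counted.\<close>

inductive destab_sequence :: "bool \<Rightarrow> nat \<Rightarrow> closed_braid \<Rightarrow> closed_braid \<Rightarrow> bool" where
  start: "destab_sequence s 0 K K"
| isotopy: "\<lbrakk>destab_sequence s q K K'; braid_isotopy K' K''\<rbrakk> \<Longrightarrow> destab_sequence s q K K''"
| exchange: "\<lbrakk>destab_sequence s q K K'; exchange_move K' K''\<rbrakk> \<Longrightarrow> destab_sequence s q K K''"
| destab: "\<lbrakk>destab_sequence s q K K'; destabilization s K' K''\<rbrakk> \<Longrightarrow>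
           destab_sequence s (Suc q) K K''"
| destab_other: "\<lbrakk>destab_sequence s q K K'; destabilization (\<not> s) K' K''\<rbrakk> \<Longrightarrow>
           destab_sequence s q K K''"

definition destabilizable :: "bool \<Rightarrow> nat \<Rightarrow> closed_braid \<Rightarrow> bool" where
  "destabilizable s p K \<longleftrightarrow> (\<exists>q\<ge>p. \<exists>K'. destab_sequence s q K K')"

abbreviation pos_destab_applicable :: "nat \<Rightarrow> closed_braid \<Rightarrow> bool" where
  "pos_destab_applicable \<equiv> destabilizable True"

abbreviation neg_destab_applicable :: "nat \<Rightarrow> closed_braid \<Rightarrow> bool" where
  "neg_destab_applicable \<equiv> destabilizable False"

section \<open>Deficits of the Morton--Franks--Williams inequality\<close>

text \<open>In the following \<^term>\<open>P\<close> is the HOMFLYPT polynomial.\<close>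

definition deficit :: "(link \<Rightarrow> laurent) \<Rightarrow> link \<Rightarrow> real" where
  "deficit P L =
     real (braid_index L) - 1 / 2 * of_int (max_deg_v (P L) - min_deg_v (P L)) - 1"

definition MFW_sharp :: "(link \<Rightarrow> laurent) \<Rightarrow> link \<Rightarrow> bool" where
  "MFW_sharp P L \<longleftrightarrow> deficit P L = 0"

definition deficit_plus :: "(link \<Rightarrow> laurent) \<Rightarrow> closed_braid \<Rightarrow> int" where
  "deficit_plus P K = (writhe K + int (strands K) - 1) - max_deg_v (P (link_type K))"

definition deficit_minus :: "(link \<Rightarrow> laurent) \<Rightarrow> closed_braid \<Rightarrow> int" where
  "deficit_minus P K = min_deg_v (P (link_type K)) - (writhe K - int (strands K) + 1)"

end

(*
  For closed braids K+, K-, K0 on m strands that form a skein triple, the writhes are c + 1, c - 1, c.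
  Hence the skein relation respects the condition that all v-degrees, taken relative to the writhe,
  lie in a fixed interval: if two members satisfy it, so does the third. For K_beta and K_gamma the
  interval is obtained from the Morton-Franks-Williams inequality for the braids at the end of the
  destabilization sequences, because a positive (negative) destabilization lowers the upper (raises
  the lower) MFW bound by 2 and no move weakens either bound.

  The MFW inequality itself follows by the same two-out-of-three principle, by induction on the
  number of strands and the length of the word.
*)

theory Submission
  imports Defs
begin

section \<open>Diagrams and their levels\<close>

text \<open>\<open>P\<close> is known only through its value on the unknot and the skein relation,
  on link types that are diagrams modulo local moves. Invariance of the closure under rotation,
  destabilization and braid relations therefore has to be produced by explicit diagram moves. Degree
  bounds alone would be vacuous for the zero polynomial, so the interval condition is coupled with
  the value of \<open>P\<close> at one point, which obeys the same two-out-of-three rule. Upper and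
  lower bounds travel together in one interval. In the sum of the two deficits the writhe cancels,
  and what is left is twice the deficit of the link.\<close>

lemma step_None: "length st < i + ins e \<Longrightarrow> step (i, e) st = None"
  by (cases e) auto

lemma step_length: "step (i, e) st = Some st' \<Longrightarrow> length st' + ins e = length st + outs e"
  by (cases e) (auto split: if_splits)

lemma step_local:
  "length p = ins e \<Longrightarrow>
   step (length a, e) (a @ p @ b) = map_option (\<lambda>p'. a @ p' @ b) (step (0, e) p)"
  by (cases e) (auto simp: nth_append numeral_2_eq_2 length_Suc_conv)

lemma run_append: "run (A @ B) st = Option.bind (run A st) (run B)"
  by (induction A arbitrary: st) (auto simp: bind_assoc split: bind_split)

text \<open>Once the level is cut into the strands of \<open>e\<close>, those of \<open>f\<close>
  and the untouched rest, the two events act on disjoint blocks, and \<open>e\<close> merely shifts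
  the position of \<open>f\<close>.\<close>

lemma run_far:
  "run [(i, e), (i + outs e + k, f)] st = run [(i + ins e + k, f), (i, e)] st"
proof (cases "length st < i + ins e + k + ins f")
  \<comment> \<open>The level is too short for \<open>f\<close> in either order, because
    \<open>e\<close> changes the length by exactly as much as the position of \<open>f\<close>. Both
    sides are \<open>None\<close>.\<close>
  case True
  have "step (i + outs e + k, f) st' = None" if "step (i, e) st = Some st'" for st'
    using step_length[OF that] True by (intro step_None) auto
  with True show ?thesis
    by (cases "step (i, e) st") (auto simp: step_None)
next
  case False
  define a p c q d where "a = take i st" and "p = take (ins e) (drop i st)"
    and "c = take k (drop (i + ins e) st)" and "q = take (ins f) (drop (i + ins e + k) st)"
    and "d = drop (i + ins e + k + ins f) st"
  have st: "st = a @ p @ c @ q @ d"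
    unfolding a_def p_def c_def q_def d_def
    by (metis add.commute append_take_drop_id drop_drop)
  have len: "length a = i" "length p = ins e" "length c = k" "length q = ins f"
    using False by (auto simp: a_def p_def c_def q_def)
  have E: "step (i, e) (a @ p @ r) = map_option (\<lambda>p'. a @ p' @ r) (step (0, e) p)" for r
    using step_local[of p e a r] len by simp
  have F: "step (length b, f) (b @ q @ d) = map_option (\<lambda>q'. b @ q' @ d) (step (0, f) q)" for b
    using step_local[of q f b d] len by simp
  have F': "step (i + outs e + k, f) (a @ p' @ c @ q @ d)
      = map_option (\<lambda>q'. a @ p' @ c @ q' @ d) (step (0, f) q)" if "step (0, e) p = Some p'" for p'
    using F[of "a @ p' @ c"] step_length[OF that] len by (simp add: add.assoc)
  have F'': "step (i + ins e + k, f) (a @ p @ c @ q @ d)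
      = map_option (\<lambda>q'. a @ p @ c @ q' @ d) (step (0, f) q)"
    using F[of "a @ p @ c"] len by (simp add: add.assoc)
  show ?thesis
    unfolding st
    by (cases "step (0, e) p"; cases "step (0, f) q") (simp_all add: E F' F'')
qed

lemma nth_decomp: "i < length st \<Longrightarrow> \<exists>a x b. st = a @ x # b \<and> length a = i"
  using id_take_nth_drop[of i st] by fastforce

lemma run_swing_cup:
  "run [(i, Cup d), (Suc i, Cross s)] st = run [(Suc i, Cup d), (i, Cross (\<not> s))] st"
proof (cases "i < length st")
  case True
  then obtain a x b where "st = a @ x # b" "length a = i"
    using nth_decomp by blast
  then show ?thesis by (auto simp: nth_append)
qed auto

lemma run_swing_cap:
  "run [(Suc i, Cross s), (i, Cap)] st = run [(i, Cross (\<not> s)), (Suc i, Cap)] st"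
proof (cases "i + 2 < length st")
  case True
  then obtain a x b where st: "st = a @ x # b" "length a = i"
    using nth_decomp[of i st] by auto
  with True obtain y z b' where "b = y # z # b'"
    by (cases b; cases "tl b") auto
  with st show ?thesis by (auto simp: nth_append)
qed auto

lemma run_R1_cup: "run [(i, Cup d), (i, Cross s)] st = run [(i, Cup (\<not> d))] st"
  by (auto simp: nth_append)

text \<open>A level stores orientations only, so the signs are arbitrary. The bound on
  \<open>i\<close> matters: on a shorter level the crossings fail while the empty diagram
  runs.\<close>

lemma run_R2:
  assumes "Suc i < length st" shows "run [(i, Cross s), (i, Cross t)] st = run [] st"
proof -
  obtain a x b where st: "st = a @ x # b" "length a = i"
    using nth_decomp[of i st] assms by auto
  with assms obtain y b' where "b = y # b'"
    by (cases b) auto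
  with st show ?thesis by (auto simp: nth_append)
qed

lemma run_R3:
  "run [(i, Cross s), (Suc i, Cross t), (i, Cross u)] st
    = run [(Suc i, Cross u), (i, Cross t), (Suc i, Cross s)] st"
proof (cases "i + 2 < length st")
  case True
  then obtain a x b where st: "st = a @ x # b" "length a = i"
    using nth_decomp[of i st] by auto
  with True obtain y z b' where "b = y # z # b'"
    by (cases b; cases "tl b") auto
  with st show ?thesis by (auto simp: nth_append)
qed auto

text \<open>A local move may be legal at some levels only (\<open>R2\<close> and the zigzags read from right to left), so
  isotopy of a part of a diagram is relative to the level \<^term>\<open>st\<close> at its bottom. The moves need not
  be legal: both sides may fail to run.\<close>

definition isotopic_at :: "bool list \<Rightarrow> diagram \<Rightarrow> diagram \<Rightarrow> bool" where
  "isotopic_at st = equivclp (\<lambda>x y. in_context local_move x y \<and> run x st = run y st)"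

lemma isotopic_at_refl [simp, intro]: "isotopic_at st x x"
  by (simp add: isotopic_at_def)

lemma isotopic_at_sym: "isotopic_at st x y \<Longrightarrow> isotopic_at st y x"
  unfolding isotopic_at_def by (rule equivclp_sym)

lemma isotopic_at_trans [trans]:
  "isotopic_at st x y \<Longrightarrow> isotopic_at st y z \<Longrightarrow> isotopic_at st x z"
  unfolding isotopic_at_def by (rule equivclp_trans)

lemma isotopic_at_trans3:
  "isotopic_at st x y \<Longrightarrow> isotopic_at st y z \<Longrightarrow> isotopic_at st z w \<Longrightarrow> isotopic_at st x w"
  by (blast intro: isotopic_at_trans)

lemma in_contextI: "R l r \<Longrightarrow> in_context R (A @ l @ B) (A @ r @ B)"
  unfolding in_context_def by blast

lemma isotopic_at_move: "local_move x y \<Longrightarrow> run x st = run y st \<Longrightarrow> isotopic_at st x y"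
  using in_contextI[of local_move x y "[]" "[]"]
  unfolding isotopic_at_def by (auto intro: r_into_equivclp)

text \<open>If \<open>A\<close> fails at \<open>s\<close>, then both diagrams fail and every step is
  run-preserving anyway. This alternative is what allows the congruence below to ignore
  legality.\<close>

lemma isotopic_at_context:
  assumes "isotopic_at st x y" and "run A s = None \<or> run A s = Some st"
  shows "isotopic_at s (A @ x @ B) (A @ y @ B)"
  using assms(1) unfolding isotopic_at_def
proof (induction rule: equivclp_induct)
  case (step y z)
  have ctx: "in_context local_move (A @ x @ B) (A @ y @ B)" if "in_context local_move x y" for x y
    using that unfolding in_context_def by (metis append.assoc)
  have "run (A @ y @ B) s = run (A @ z @ B) s"
    using step(2) assms(2) by (auto simp: run_append)
  with step(2) have "equivclp (\<lambda>x y. in_context local_move x y \<and> run x s = run y s)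
      (A @ y @ B) (A @ z @ B)"
    by (elim disjE) (simp_all add: ctx r_into_equivclp converse_r_into_equivclp)
  with step.IH show ?case by (rule equivclp_trans)
qed simp

lemma isotopic_at_congruence:
  "(\<And>st. isotopic_at st x y) \<Longrightarrow> isotopic_at s (A @ x @ B) (A @ y @ B)"
  by (cases "run A s") (auto intro: isotopic_at_context)

text \<open>The moves with an empty side, \<open>R2\<close> and the zigzags, cannot run at the empty
  level. Hence no step turns a link diagram into the empty list, which \<open>link_diagram\<close>
  excludes.\<close>

lemma local_move_nonempty:
  "local_move l r \<Longrightarrow> run l [] = run r [] \<Longrightarrow> l \<noteq> [] \<and> r \<noteq> []"
  by (cases rule: local_move.cases) (auto split: if_splits)

lemma link_diagram_step:
  assumes "in_context local_move x y" "run x [] = run y []"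
  shows "link_diagram x \<longleftrightarrow> link_diagram y"
proof -
  obtain A l r B where d: "local_move l r" "x = A @ l @ B" "y = A @ r @ B"
    using assms(1) unfolding in_context_def by blast
  then have "x = [] \<longleftrightarrow> y = []"
    using local_move_nonempty[of l r] assms(2) 
    by (cases "A = [] \<and> B = []") (auto dest: local_move_nonempty)
  with assms(2) show ?thesis by (simp add: link_diagram_def)
qed

text \<open>The way back to the official relation: each step preserves the result of running and
  nonemptiness, so a chain starting at a link diagram consists of link diagrams.\<close>

lemma isotopic_at_isotopic:
  assumes "isotopic_at [] D D'" and "link_diagram D"
  shows "isotopic D D'"
proof -
  let ?R = "\<lambda>x y. link_diagram x \<and> link_diagram y \<and> in_context local_move x y"
  have "equivclp ?R D D' \<and> link_diagram D'"
    using assms(1) unfolding isotopic_at_def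
  proof (induction rule: equivclp_induct)
    case (step y z)
    then have "?R y z \<or> ?R z y"
      using link_diagram_step by metis
    then have "equivclp ?R y z"
      using r_into_equivclp[of ?R] converse_r_into_equivclp[of ?R] by blast
    then show ?case
      using step.IH \<open>?R y z \<or> ?R z y\<close> equivclp_trans[of ?R D y z] by blast
  qed (use assms in auto)
  with assms show ?thesis by (simp add: isotopic_def)
qed

section \<open>Planar isotopies that slide and swing crossings\<close>

lemma isotopic_at_far:
  "isotopic_at st [(i, e), (i + outs e + k, f)] [(i + ins e + k, f), (i, e)]"
  by (intro isotopic_at_move local_move.far run_far)

lemma isotopic_at_swing_cup:
  "isotopic_at st [(i, Cup d), (Suc i, Cross s)] [(Suc i, Cup d), (i, Cross (\<not> s))]"
  by (intro isotopic_at_move run_swing_cup) (use local_move.swing_cup[of i d s] in simp)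

lemma isotopic_at_swing_cap:
  "isotopic_at st [(Suc i, Cross s), (i, Cap)] [(i, Cross (\<not> s)), (Suc i, Cap)]"
  by (intro isotopic_at_move run_swing_cap) (use local_move.swing_cap[of i s] in simp)

text \<open>A crossing has as many outgoing as incoming strands, so events to its right keep their
  positions.\<close>

lemma slide_cross_right:
  assumes "\<And>j f. (j, f) \<in> set xs \<Longrightarrow> i + 2 \<le> j"
  shows "isotopic_at st ((i, Cross s) # xs) (xs @ [(i, Cross s)])"
  using assms
proof (induction xs arbitrary: st)
  case (Cons x xs)
  obtain k f where x: "x = (i + 2 + k, f)"
    using Cons.prems[of "fst x" "snd x"] by (metis le_Suc_ex list.set_intros(1) prod.collapse)
  have "isotopic_at st ([] @ [(i, Cross s), x] @ xs) ([] @ [x, (i, Cross s)] @ xs)"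
    using isotopic_at_far[of _ i "Cross s" k f] x by (intro isotopic_at_congruence) simp
  moreover have "isotopic_at st ([x] @ ((i, Cross s) # xs) @ []) ([x] @ (xs @ [(i, Cross s)]) @ [])"
    by (intro isotopic_at_congruence Cons) (use Cons.prems in auto)
  ultimately show ?case
    by - (simp, rule isotopic_at_trans)
qed simp

lemma slide_past_crossings:
  assumes "\<And>j f. (j, f) \<in> set xs \<Longrightarrow> j + 2 \<le> i \<and> (\<exists>s. f = Cross s)"
  shows "isotopic_at st ((i, e) # xs) (xs @ [(i, e)])"
  using assms
proof (induction xs arbitrary: st)
  case (Cons x xs)
  obtain j s where x: "x = (j, Cross s)" "j + 2 \<le> i"
    using Cons.prems[of "fst x" "snd x"] by (cases x) auto
  then obtain k where k: "i = j + 2 + k"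
    using le_Suc_ex by blast
  have "isotopic_at st ([] @ [(i, e), x] @ xs) ([] @ [x, (i, e)] @ xs)"
    using isotopic_at_far[of _ j "Cross s" k e, THEN isotopic_at_sym] x k
    by (intro isotopic_at_congruence) simp
  moreover have "isotopic_at st ([x] @ ((i, e) # xs) @ []) ([x] @ (xs @ [(i, e)]) @ [])"
    by (intro isotopic_at_congruence Cons) (use Cons.prems in auto)
  ultimately show ?case
    by - (simp, rule isotopic_at_trans)
qed simp

section \<open>Conjugation and destabilization of closed braids\<close>

definition cups :: "nat \<Rightarrow> nat \<Rightarrow> diagram" where
  "cups a b = map (\<lambda>j. (j, Cup True)) [a..<b]"

definition caps :: "nat \<Rightarrow> nat \<Rightarrow> diagram" where
  "caps a b = map (\<lambda>j. (j, Cap)) (rev [a..<b])"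

definition crossings :: "braid_word \<Rightarrow> diagram" where
  "crossings = map (\<lambda>(i, s). (i - 1, Cross s))"

lemma braid_closure_eq: "braid_closure (m, w) = cups 0 m @ crossings w @ caps 0 m"
  by (simp add: braid_closure_def cups_def caps_def crossings_def)

lemma crossings_simps [simp]:
  "crossings [] = []" "crossings ((i, s) # w) = (i - 1, Cross s) # crossings w"
  "crossings (u @ w) = crossings u @ crossings w"
  by (simp_all add: crossings_def)

lemma cups_split: "a \<le> b \<Longrightarrow> b \<le> c \<Longrightarrow> cups a c = cups a b @ cups b c"
  unfolding cups_def using upt_add_eq_append[of a b "c - b"] by simp

lemma caps_split: "a \<le> b \<Longrightarrow> b \<le> c \<Longrightarrow> caps a c = caps b c @ caps a b"
  unfolding caps_def using upt_add_eq_append[of a b "c - b"] by simp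

lemma cups_Suc: "cups m (Suc m) = [(m, Cup True)]" "cups m (Suc (Suc m)) = [(m, Cup True), (Suc m, Cup True)]"
  by (simp_all add: cups_def)

lemma caps_Suc: "caps m (Suc m) = [(m, Cap)]" "caps m (Suc (Suc m)) = [(Suc m, Cap), (m, Cap)]"
  by (simp_all add: caps_def)

text \<open>Each cup passed creates two strands to the left of the crossing, hence the shift
  \<open>2 * n\<close>. The hypothesis survives the induction since \<open>a\<close> grows by 1 and
  \<open>p\<close> by 2.\<close>

lemma slide_cups:
  "a \<le> p \<Longrightarrow> isotopic_at st ((p, Cross s) # cups a (a + n)) (cups a (a + n) @ [(p + 2 * n, Cross s)])"
proof (induction n arbitrary: a p st)
  case (Suc n)
  have c: "cups a (a + Suc n) = (a, Cup True) # cups (Suc a) (Suc a + n)"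
    using cups_split[of a "Suc a" "a + Suc n"] by (simp add: cups_Suc)
  have "isotopic_at st ([] @ [(p, Cross s), (a, Cup True)] @ cups (Suc a) (Suc a + n))
     ([] @ [(a, Cup True), (p + 2, Cross s)] @ cups (Suc a) (Suc a + n))"
    using isotopic_at_far[of _ a "Cup True" "p - a" "Cross s"] Suc.prems
    by (intro isotopic_at_congruence) (auto intro: isotopic_at_sym)
  moreover have "isotopic_at st ([(a, Cup True)] @ ((p + 2, Cross s) # cups (Suc a) (Suc a + n)) @ [])
     ([(a, Cup True)] @ (cups (Suc a) (Suc a + n) @ [(p + 2 + 2 * n, Cross s)]) @ [])"
    by (intro isotopic_at_congruence Suc) (use Suc.prems in auto)
  ultimately show ?case unfolding c
    by - (simp, rule isotopic_at_trans)
qed (simp add: cups_def)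

lemma slide_caps:
  "a \<le> p \<Longrightarrow> isotopic_at st (caps a (a + n) @ [(p, Cross s)]) ((p + 2 * n, Cross s) # caps a (a + n))"
proof (induction n arbitrary: a p st)
  case (Suc n)
  have c: "caps a (a + Suc n) = caps (Suc a) (Suc a + n) @ [(a, Cap)]"
    using caps_split[of a "Suc a" "a + Suc n"] by (simp add: caps_Suc)
  have "isotopic_at st (caps (Suc a) (Suc a + n) @ [(a, Cap), (p, Cross s)] @ [])
     (caps (Suc a) (Suc a + n) @ [(p + 2, Cross s), (a, Cap)] @ [])"
    using isotopic_at_far[of _ a "Cap" "p - a" "Cross s"] Suc.prems
    by (intro isotopic_at_congruence) auto
  moreover have "isotopic_at st ([] @ (caps (Suc a) (Suc a + n) @ [(p + 2, Cross s)]) @ [(a, Cap)])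
     ([] @ ((p + 2 + 2 * n, Cross s) # caps (Suc a) (Suc a + n)) @ [(a, Cap)])"
    by (intro isotopic_at_congruence Suc) (use Suc.prems in auto)
  ultimately show ?case unfolding c
    by - (simp, rule isotopic_at_trans)
qed (simp add: caps_def)

text \<open>The crossing moves from the left legs to the right legs of two nested minima. Halfway
  the minima lie side by side with the crossing between them; each of the two swings flips the sign,
  so it is restored. The maxima below are treated in the same way.\<close>

lemma swing_nested_cups:
  "isotopic_at st [(j, Cup d), (Suc j, Cup d), (j, Cross s)] [(j, Cup d), (Suc j, Cup d), (j + 2, Cross s)]"
proof -
  have "isotopic_at st ([(j, Cup d)] @ [(Suc j, Cup d), (j, Cross s)] @ [])
      ([(j, Cup d)] @ [(j, Cup d), (Suc j, Cross (\<not> s))] @ [])"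
    using isotopic_at_swing_cup[of _ j d "\<not> s"]
    by (intro isotopic_at_congruence) (auto intro: isotopic_at_sym)
  also have "isotopic_at st ([] @ [(j, Cup d), (j, Cup d)] @ [(Suc j, Cross (\<not> s))])
      ([] @ [(j, Cup d), (j + 2, Cup d)] @ [(Suc j, Cross (\<not> s))])"
    using isotopic_at_far[of _ j "Cup d" 0 "Cup d"]
    by (intro isotopic_at_congruence) (auto intro: isotopic_at_sym)
  then have "isotopic_at st ([(j, Cup d)] @ [(j, Cup d), (Suc j, Cross (\<not> s))] @ [])
      [(j, Cup d), (j + 2, Cup d), (Suc j, Cross (\<not> s))]"
    by simp
  also have "isotopic_at st ([(j, Cup d)] @ [(j + 2, Cup d), (Suc j, Cross (\<not> s))] @ [])
      ([(j, Cup d)] @ [(Suc j, Cup d), (j + 2, Cross s)] @ [])"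
    using isotopic_at_swing_cup[of _ "Suc j" d s]
    by (intro isotopic_at_congruence) (auto intro: isotopic_at_sym)
  then have "isotopic_at st [(j, Cup d), (j + 2, Cup d), (Suc j, Cross (\<not> s))]
      [(j, Cup d), (Suc j, Cup d), (j + 2, Cross s)]"
    by simp
  finally show ?thesis by simp
qed

lemma swing_nested_caps:
  "isotopic_at st [(j, Cross s), (Suc j, Cap), (j, Cap)] [(j + 2, Cross s), (Suc j, Cap), (j, Cap)]"
proof -
  have "isotopic_at st ([] @ [(j, Cross s), (Suc j, Cap)] @ [(j, Cap)])
      ([] @ [(Suc j, Cross (\<not> s)), (j, Cap)] @ [(j, Cap)])"
    using isotopic_at_swing_cap[of _ j "\<not> s"]
    by (intro isotopic_at_congruence) (auto intro: isotopic_at_sym)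
  also have "isotopic_at st ([(Suc j, Cross (\<not> s))] @ [(j, Cap), (j, Cap)] @ [])
      ([(Suc j, Cross (\<not> s))] @ [(j + 2, Cap), (j, Cap)] @ [])"
    using isotopic_at_far[of _ j Cap 0 Cap]
    by (intro isotopic_at_congruence) auto
  then have "isotopic_at st ([] @ [(Suc j, Cross (\<not> s)), (j, Cap)] @ [(j, Cap)])
      [(Suc j, Cross (\<not> s)), (j + 2, Cap), (j, Cap)]"
    by simp
  also have "isotopic_at st ([] @ [(Suc j, Cross (\<not> s)), (j + 2, Cap)] @ [(j, Cap)])
      ([] @ [(j + 2, Cross s), (Suc j, Cap)] @ [(j, Cap)])"
    using isotopic_at_swing_cap[of _ "Suc j" s]
    by (intro isotopic_at_congruence) (auto intro: isotopic_at_sym)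
  then have "isotopic_at st [(Suc j, Cross (\<not> s)), (j + 2, Cap), (j, Cap)]
      [(j + 2, Cross s), (Suc j, Cap), (j, Cap)]"
    by simp
  finally show ?thesis by simp
qed

text \<open>A crossing of two braid strands slides through the nested extrema to the return strands of the
  same two arcs. There it can pass all braid crossings, which gives invariance under conjugation.\<close>

lemma cross_through_cups:
  assumes "j + 1 < m"
  shows "isotopic_at st (cups 0 m @ [(j, Cross s)]) (cups 0 m @ [(2 * m - 2 - j, Cross s)])"
proof -
  let ?c = "cups (j + 2) m" and ?b = "[(j, Cup True), (Suc j, Cup True)]"
  \<comment> \<open>The arcs starting at \<open>j\<close> and \<open>j + 1\<close> return at
    \<open>2 * m - 1 - j\<close> and \<open>2 * m - 2 - j\<close>; a crossing is indexed by its left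
    strand.\<close>
  have J: "j + 2 + (m - j - 2) = m" "j + 2 + 2 * (m - j - 2) = 2 * m - 2 - j"
    using assms by auto
  have c: "cups 0 m = cups 0 j @ ?b @ ?c"
    using assms cups_split[of 0 j m] cups_split[of j "Suc (Suc j)" m] by (simp add: cups_Suc)
  have "isotopic_at st ((cups 0 j @ ?b) @ (?c @ [(j, Cross s)]) @ [])
     ((cups 0 j @ ?b) @ ((j, Cross s) # ?c) @ [])"
    by (intro isotopic_at_congruence isotopic_at_sym[OF slide_cross_right]) (auto simp: cups_def)
  moreover have "isotopic_at st (cups 0 j @ (?b @ [(j, Cross s)]) @ ?c)
     (cups 0 j @ (?b @ [(j + 2, Cross s)]) @ ?c)"
    using swing_nested_cups by (intro isotopic_at_congruence) auto
  moreover have "isotopic_at st ((cups 0 j @ ?b) @ ((j + 2, Cross s) # ?c) @ [])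
     ((cups 0 j @ ?b) @ (?c @ [(2 * m - 2 - j, Cross s)]) @ [])"
    using slide_cups[of "j + 2" "j + 2" _ s "m - j - 2"] assms J
    by (intro isotopic_at_congruence) simp
  ultimately show ?thesis
    unfolding c by - (simp, rule isotopic_at_trans3)
qed

lemma cross_through_caps:
  assumes "j + 1 < m"
  shows "isotopic_at st ((j, Cross s) # caps 0 m) ((2 * m - 2 - j, Cross s) # caps 0 m)"
proof -
  let ?c = "caps (j + 2) m" and ?b = "[(Suc j, Cap), (j, Cap)]"
  have J: "j + 2 + (m - j - 2) = m" "j + 2 + 2 * (m - j - 2) = 2 * m - 2 - j"
    using assms by auto
  have c: "caps 0 m = ?c @ ?b @ caps 0 j"
    using assms caps_split[of 0 j m] caps_split[of j "Suc (Suc j)" m] by (simp add: caps_Suc)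
  have "isotopic_at st ([] @ ((j, Cross s) # ?c) @ ?b @ caps 0 j)
     ([] @ (?c @ [(j, Cross s)]) @ ?b @ caps 0 j)"
    by (intro isotopic_at_congruence slide_cross_right) (auto simp: caps_def)
  moreover have "isotopic_at st (?c @ ((j, Cross s) # ?b) @ caps 0 j)
     (?c @ ((j + 2, Cross s) # ?b) @ caps 0 j)"
    using swing_nested_caps by (intro isotopic_at_congruence) auto
  moreover have "isotopic_at st ([] @ (?c @ [(j + 2, Cross s)]) @ ?b @ caps 0 j)
     ([] @ ((2 * m - 2 - j, Cross s) # ?c) @ ?b @ caps 0 j)"
    using slide_caps[of "j + 2" "j + 2" _ "m - j - 2" s] assms J
    by (intro isotopic_at_congruence) simp
  ultimately show ?thesis
    unfolding c by - (simp, rule isotopic_at_trans3)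
qed

section \<open>Levels inside the closure of a braid\<close>

lemma braid_words_simps [simp]:
  "[] \<in> braid_words J" "(i, s) # w \<in> braid_words J \<longleftrightarrow> i \<in> J \<and> w \<in> braid_words J"
  "u @ w \<in> braid_words J \<longleftrightarrow> u \<in> braid_words J \<and> w \<in> braid_words J"
  by (auto simp: braid_words_def)

lemma crossings_bound:
  assumes "w \<in> braid_words {1..<m}" "(j, f) \<in> set (crossings w)"
  shows "j + 2 \<le> m \<and> (\<exists>s. f = Cross s)"
  using assms by (induction w) (auto simp: split_paired_all)

abbreviation braid_level :: "nat \<Rightarrow> bool list" where
  "braid_level m \<equiv> replicate m True @ replicate m False"

lemma run_cups: "run (cups 0 m) [] = Some (braid_level m)"
  by (induction m) (simp_all add: cups_def run_append replicate_append_same replicate_app_Cons_same)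

lemma run_caps: "run (caps 0 m) (braid_level m) = Some []"
proof (induction m)
  case (Suc m)
  have "run (caps 0 (Suc m)) st = run ((m, Cap) # caps 0 m) st" for st
    by (simp add: caps_def)
  moreover have "replicate (Suc m) True = replicate m True @ [True]"
    by (simp add: replicate_append_same)
  ultimately show ?case
    using Suc by (simp add: nth_append del: replicate_Suc)
qed (simp add: caps_def)

lemma run_crossings:
  "w \<in> braid_words {1..<m} \<Longrightarrow> run (crossings w) (braid_level m) = Some (braid_level m)"
proof (induction w)
  case (Cons x w)
  obtain i s where x: "x = (i, s)" by fastforce
  with Cons.prems have i: "1 \<le> i" "i < m" by auto
  then have m: "m = (i - 1) + (Suc (Suc (m - i - 1)))" by simp
  have "replicate m True = replicate (i - 1) True @ [True, True] @ replicate (m - i - 1) True"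
    by (subst m, subst replicate_add) simp
  then have "braid_level m = replicate (i - 1) True @ True # True # replicate (m - i - 1) True @ replicate m False"
    by simp
  then obtain a b where ab: "braid_level m = a @ True # True # b" "length a = i - 1"
    by (metis length_replicate)
  have "step (i - 1, Cross s) (braid_level m) = Some (braid_level m)"
    unfolding ab(1) using ab(2) by (auto simp: nth_append)
  then show ?case using Cons x by (simp del: step.simps)
qed simp

lemma link_diagram_closure: "is_closed_braid K \<Longrightarrow> link_diagram (braid_closure K)"
  by (cases K) (auto simp: is_closed_braid_def braid_closure_eq link_diagram_def run_append
      run_cups run_caps run_crossings, simp add: cups_def)

lemma isotopic_link_of: "isotopic D D' \<Longrightarrow> link_of D = link_of D'"
  using Quotient3_rel[OF Quotient3_link] by metis

lemma link_typeI:
  "is_closed_braid K \<Longrightarrow> isotopic_at [] (braid_closure K) (braid_closure K') \<Longrightarrow>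
    link_type K = link_type K'"
  unfolding link_type_def
  by (intro isotopic_link_of isotopic_at_isotopic link_diagram_closure)

section \<open>Link type under cyclic rotation, destabilization and braid relations\<close>

lemma link_type_rotate1:
  assumes "(i, s) # w \<in> braid_words {1..<m}"
  shows "link_type (m, (i, s) # w) = link_type (m, w @ [(i, s)])"
proof (rule link_typeI)
  define j where "j = i - 1"
  have j: "j + 1 < m" "1 \<le> i" using assms by (auto simp: j_def)
  let ?J = "2 * m - 2 - j"
  show "is_closed_braid (m, (i, s) # w)"
    using assms j by (auto simp: is_closed_braid_def)
  have "isotopic_at [] ([] @ (cups 0 m @ [(j, Cross s)]) @ crossings w @ caps 0 m)
     ([] @ (cups 0 m @ [(?J, Cross s)]) @ crossings w @ caps 0 m)"
    by (intro isotopic_at_congruence cross_through_cups j)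
  \<comment> \<open>Here \<open>?J\<close> is at least \<open>m\<close>, so the crossing lies to the
    right of all braid crossings.\<close>
  moreover have "isotopic_at [] (cups 0 m @ ((?J, Cross s) # crossings w) @ caps 0 m)
     (cups 0 m @ (crossings w @ [(?J, Cross s)]) @ caps 0 m)"
    using crossings_bound[of w m] assms j
    by (intro isotopic_at_congruence slide_past_crossings) fastforce
  moreover have "isotopic_at [] ((cups 0 m @ crossings w) @ ((?J, Cross s) # caps 0 m) @ [])
     ((cups 0 m @ crossings w) @ ((j, Cross s) # caps 0 m) @ [])"
    by (intro isotopic_at_congruence isotopic_at_sym[OF cross_through_caps] j)
  ultimately show "isotopic_at [] (braid_closure (m, (i, s) # w)) (braid_closure (m, w @ [(i, s)]))"
    unfolding braid_closure_eq crossings_simps j_def[symmetric]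
    by - (simp, rule isotopic_at_trans3)
qed

lemma link_type_rotate:
  "u @ w \<in> braid_words {1..<m} \<Longrightarrow> link_type (m, u @ w) = link_type (m, w @ u)"
proof (induction u arbitrary: w)
  case (Cons x u)
  then show ?case
    using link_type_rotate1[of "fst x" "snd x" "u @ w" m] Cons.IH[of "w @ [x]"]
    by (cases x) auto
qed simp

text \<open>The last strand and its return strand form the innermost arc, whose minimum can rise
  past all crossings of \<open>x\<close>. The remaining cup, crossing and cap are a kink: a swing
  makes the crossing a curl at the minimum, a first Reidemeister move removes it, and a zigzag
  straightens the arc.\<close>

lemma link_type_destab:
  assumes "x \<in> braid_words {1..<m}" "1 \<le> m"
  shows "link_type (Suc m, x @ [(m, s)]) = link_type (m, x)"
proof (rule link_typeI)
  have x: "x \<in> braid_words {1..<Suc m}"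
    using assms(1) by (auto simp: braid_words_def)
  then show "is_closed_braid (Suc m, x @ [(m, s)])"
    using assms(2) by (auto simp: is_closed_braid_def)
  obtain k where k: "m = Suc k" using assms(2) by (cases m) auto
  have cups: "cups 0 (Suc m) = cups 0 m @ [(m, Cup True)]"
    and caps: "caps 0 (Suc m) = [(m, Cap)] @ caps 0 m"
    using cups_split[of 0 m "Suc m"] caps_split[of 0 m "Suc m"] by (simp_all add: cups_Suc caps_Suc)
  have curl: "isotopic_at (braid_level m) [(m, Cup True), (k, Cross s), (m, Cap)] []"
  proof -
    let ?st = "braid_level m"
    have "isotopic_at ?st ([(m, Cup True)] @ [(k, Cross s), (m, Cap)] @ [])
       ([(m, Cup True)] @ [(m, Cross (\<not> s)), (k, Cap)] @ [])"
      using isotopic_at_swing_cap[of _ k "\<not> s"] k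
      by (intro isotopic_at_congruence) (auto intro: isotopic_at_sym)
    moreover have "isotopic_at ?st ([] @ [(m, Cup True), (m, Cross (\<not> s))] @ [(k, Cap)])
       ([] @ [(m, Cup False)] @ [(k, Cap)])"
      using local_move.R1_cup[of m True "\<not> s"] run_R1_cup[of m True "\<not> s"]
      by (intro isotopic_at_congruence isotopic_at_move) auto
    \<comment> \<open>The cap is legal only because strand \<open>k\<close> points upwards and the
      new strand next to it downwards. This is why \<open>curl\<close> is tied to the level
      \<open>braid_level m\<close>.\<close>
    moreover have "isotopic_at ?st [(m, Cup False), (k, Cap)] []"
    proof (rule isotopic_at_move)
      have "?st = replicate k True @ True # replicate m False"
        by (simp add: k replicate_app_Cons_same)
      then show "run [(m, Cup False), (k, Cap)] ?st = run [] ?st"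
        by (simp add: k nth_append del: replicate_Suc)
    qed (use local_move.zigzag2[of k False] k in simp)
    ultimately show ?thesis
      by - (simp, rule isotopic_at_trans3)
  qed
  have "isotopic_at [] (cups 0 m @ ((m, Cup True) # crossings x) @ [(k, Cross s), (m, Cap)] @ caps 0 m)
     (cups 0 m @ (crossings x @ [(m, Cup True)]) @ [(k, Cross s), (m, Cap)] @ caps 0 m)"
    using crossings_bound[OF assms(1)]
    by (intro isotopic_at_congruence slide_past_crossings) fastforce
  moreover have "isotopic_at [] ((cups 0 m @ crossings x) @ [(m, Cup True), (k, Cross s), (m, Cap)] @ caps 0 m)
     ((cups 0 m @ crossings x) @ [] @ caps 0 m)"
    by (intro isotopic_at_context[OF curl]) (simp add: run_append run_cups run_crossings[OF assms(1)])
  ultimately show "isotopic_at [] (braid_closure (Suc m, x @ [(m, s)])) (braid_closure (m, x))"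
    unfolding braid_closure_eq cups caps crossings_simps
    using k by - (simp, rule isotopic_at_trans)
qed

text \<open>The three braid relations become \<open>R2\<close>, \<open>far\<close> and
  \<open>R3\<close>. The level below them, \<open>braid_level m\<close>, is wide enough for
  \<open>R2\<close> to be legal in both directions.\<close>

lemma link_type_relation:
  assumes "in_context braid_relation x y" "x \<in> braid_words {1..<m}" "1 \<le> m"
  shows "link_type (m, x) = link_type (m, y)"
proof (rule link_typeI)
  show "is_closed_braid (m, x)" using assms by (simp add: is_closed_braid_def)
  obtain A l r B where d: "braid_relation l r" "x = A @ l @ B" "y = A @ r @ B"
    using assms(1) unfolding in_context_def by blast
  have l: "l \<in> braid_words {1..<m}" "A \<in> braid_words {1..<m}" using assms(2) d by auto
  have "isotopic_at (braid_level m) (crossings l) (crossings r)"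
    using d(1)
  proof cases
    case (cancel i s)
    then show ?thesis
      using l local_move.R2[of "i - 1" s] run_R2[of "i - 1" "braid_level m" s "\<not> s"]
      by (auto intro!: isotopic_at_move)
  next
    case (commute i j s t)
    then show ?thesis
      using l isotopic_at_far[of _ "i - 1" "Cross s" "j - i - 2" "Cross t"]
      by (auto simp: numeral_2_eq_2 Suc_diff_Suc)
  next
    case (braid i)
    then obtain j where "i = Suc j"
      using l by (cases i) auto
    then show ?thesis
      using braid local_move.R3[of True True True j] run_R3[of j True True True]
      by (auto intro!: isotopic_at_move simp del: run.simps)
  qed
  then have "isotopic_at [] ((cups 0 m @ crossings A) @ crossings l @ (crossings B @ caps 0 m))
     ((cups 0 m @ crossings A) @ crossings r @ (crossings B @ caps 0 m))"
    by (rule isotopic_at_context) (simp add: run_append run_cups run_crossings[OF l(2)])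
  then show "isotopic_at [] (braid_closure (m, x)) (braid_closure (m, y))"
    by (simp add: braid_closure_eq d)
qed

section \<open>Degrees of the HOMFLYPT polynomial\<close>

text \<open>Additively, Laurent polynomials are free on the monomials and both sides are additive in
  \<open>p\<close>, so \<open>frag_induction\<close> reduces the claim to one monomial.\<close>

lemma lookup_mono_vz_mult:
  "Poly_Mapping.lookup (mono_vz a b * p) k = Poly_Mapping.lookup p (k - (a, b))"
  using subset_UNIV[of "Poly_Mapping.keys p"]
proof (induction p rule: frag_induction)
  case (one x)
  then show ?case
    by (cases x; cases k) (auto simp: mono_vz_def mult_single lookup_single when_def)
qed (simp_all add: right_diff_distrib lookup_minus)

lemma keys_mono_vz_mult:
  "Poly_Mapping.keys (mono_vz a b * p) = (+) (a, b) ` Poly_Mapping.keys p"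
proof -
  have "k \<in> (+) (a, b) ` Poly_Mapping.keys p" if "k - (a, b) \<in> Poly_Mapping.keys p" for k
    using that by (intro image_eqI[of _ _ "k - (a, b)"]) auto
  then show ?thesis
    by (auto simp: in_keys_iff lookup_mono_vz_mult)
qed

text \<open>The point \<open>v = 2\<close>, \<open>z = - 3/2\<close> lies on the curve \<open>1/v - v = z\<close>, on which the constant 1 solves the
  skein relation. So the HOMFLYPT polynomial has value 1 there, and in particular it is not 0 (the
  degree of 0 is a junk value).\<close>

definition eval_vz :: "laurent \<Rightarrow> real" where
  "eval_vz p = (\<Sum>k\<in>Poly_Mapping.keys p.
     of_int (Poly_Mapping.lookup p k) * 2 powi fst k * (-3/2) powi snd k)"

lemma eval_vz_superset:
  "finite S \<Longrightarrow> Poly_Mapping.keys p \<subseteq> S \<Longrightarrow>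
   eval_vz p = (\<Sum>k\<in>S. of_int (Poly_Mapping.lookup p k) * 2 powi fst k * (-3/2) powi snd k)"
  unfolding eval_vz_def by (intro sum.mono_neutral_left) (auto simp: in_keys_iff)

lemma eval_vz_diff: "eval_vz (p - q) = eval_vz p - eval_vz q"
proof -
  let ?S = "Poly_Mapping.keys p \<union> Poly_Mapping.keys q"
  show ?thesis
    using eval_vz_superset[of ?S p] eval_vz_superset[of ?S q] eval_vz_superset[of ?S "p - q"]
    by (simp add: keys_diff lookup_minus algebra_simps sum_subtractf)
qed

lemma eval_vz_mono_vz_mult: "eval_vz (mono_vz a b * p) = 2 powi a * (-3/2) powi b * eval_vz p"
proof -
  have "inj_on ((+) (a, b)) (Poly_Mapping.keys p)" by simp
  then show ?thesis
    unfolding eval_vz_def keys_mono_vz_mult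
    by (simp add: sum.reindex lookup_mono_vz_mult sum_distrib_left power_int_add del: minus_divide_left)
      (simp add: mult_ac)
qed

lemma eval_vz_one: "eval_vz 1 = 1"
  by (simp add: eval_vz_def zero_prod_def[symmetric] lookup_one)

text \<open>The second conjunct holds vacuously for 0; the first one excludes 0, so that
  \<open>Max\<close> and \<open>Min\<close> range over a nonempty set.\<close>

definition v_band :: "int \<Rightarrow> int \<Rightarrow> laurent \<Rightarrow> bool" where
  "v_band a b p \<longleftrightarrow> eval_vz p = 1 \<and> (\<forall>k\<in>Poly_Mapping.keys p. a \<le> fst k \<and> fst k \<le> b)"

lemma v_band_mono: "v_band a b p \<Longrightarrow> a' \<le> a \<Longrightarrow> b \<le> b' \<Longrightarrow> v_band a' b' p"
  unfolding v_band_def by fastforce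

lemma v_band_degrees:
  assumes "v_band a b p"
  shows "a \<le> min_deg_v p" "max_deg_v p \<le> b"
proof -
  have "Poly_Mapping.keys p \<noteq> {}"
    using assms by (auto simp: v_band_def eval_vz_def)
  with assms show "a \<le> min_deg_v p" "max_deg_v p \<le> b"
    by (auto simp: v_band_def min_deg_v_def max_deg_v_def)
qed

lemma keys_linear_relation:
  fixes p q r :: laurent
  assumes "p - q = r"
  shows "Poly_Mapping.keys p \<subseteq> Poly_Mapping.keys q \<union> Poly_Mapping.keys r"
    and "Poly_Mapping.keys q \<subseteq> Poly_Mapping.keys p \<union> Poly_Mapping.keys r"
    and "Poly_Mapping.keys r \<subseteq> Poly_Mapping.keys p \<union> Poly_Mapping.keys q"
proof -
  have "p = q + r" "q = p - r" using assms by (auto simp: algebra_simps)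
  then show "Poly_Mapping.keys p \<subseteq> Poly_Mapping.keys q \<union> Poly_Mapping.keys r"
    "Poly_Mapping.keys q \<subseteq> Poly_Mapping.keys p \<union> Poly_Mapping.keys r"
    "Poly_Mapping.keys r \<subseteq> Poly_Mapping.keys p \<union> Poly_Mapping.keys q"
    using assms keys_add[of q r] keys_diff[of p r] keys_diff[of p q] by auto
qed

text \<open>The factors \<open>1/v\<close>, \<open>v\<close> and \<open>z\<close> carry the three
  bands to the common band from \<open>c + a\<close> to \<open>c + b\<close>, and in a linear
  relation each support lies in the union of the other two. The values agree because 1/2 - 2 =
  -3/2.\<close>

lemma v_band_skein:
  assumes eq: "mono_vz (-1) 0 * pp - mono_vz 1 0 * pm = mono_vz 0 1 * p0"
  shows "v_band (c - 1 + a) (c - 1 + b) pm \<Longrightarrow> v_band (c + a) (c + b) p0 \<Longrightarrow>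
      v_band (c + 1 + a) (c + 1 + b) pp"
    and "v_band (c + 1 + a) (c + 1 + b) pp \<Longrightarrow> v_band (c + a) (c + b) p0 \<Longrightarrow>
      v_band (c - 1 + a) (c - 1 + b) pm"
    and "v_band (c + 1 + a) (c + 1 + b) pp \<Longrightarrow> v_band (c - 1 + a) (c - 1 + b) pm \<Longrightarrow>
      v_band (c + a) (c + b) p0"
proof -
  have ev: "eval_vz pp / 2 - 2 * eval_vz pm = - 3 / 2 * eval_vz p0"
    using arg_cong[OF eq, of eval_vz]
    by (simp add: eval_vz_diff eval_vz_mono_vz_mult power_int_minus)
  define D where
    "D q \<longleftrightarrow> (\<forall>k\<in>Poly_Mapping.keys q. c + a \<le> fst k \<and> fst k \<le> c + b)" for q :: laurent
  have less: "1 + x \<le> y \<longleftrightarrow> x < y" for x y :: int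
    by auto
  have "v_band (c + 1 + a) (c + 1 + b) pp \<longleftrightarrow> eval_vz pp = 1 \<and> D (mono_vz (-1) 0 * pp)"
    "v_band (c - 1 + a) (c - 1 + b) pm \<longleftrightarrow> eval_vz pm = 1 \<and> D (mono_vz 1 0 * pm)"
    "v_band (c + a) (c + b) p0 \<longleftrightarrow> eval_vz p0 = 1 \<and> D (mono_vz 0 1 * p0)"
    by (simp_all add: v_band_def D_def keys_mono_vz_mult) (simp_all add: algebra_simps less)
  note band = this
  have "D q" if "Poly_Mapping.keys q \<subseteq> Poly_Mapping.keys r \<union> Poly_Mapping.keys t" "D r" "D t" for q r t
    using that unfolding D_def by blast
  note D = this[OF keys_linear_relation(1)[OF eq]] this[OF keys_linear_relation(2)[OF eq]]
    this[OF keys_linear_relation(3)[OF eq]]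
  show "v_band (c - 1 + a) (c - 1 + b) pm \<Longrightarrow> v_band (c + a) (c + b) p0 \<Longrightarrow>
      v_band (c + 1 + a) (c + 1 + b) pp"
    and "v_band (c + 1 + a) (c + 1 + b) pp \<Longrightarrow> v_band (c + a) (c + b) p0 \<Longrightarrow>
      v_band (c - 1 + a) (c - 1 + b) pm"
    and "v_band (c + 1 + a) (c + 1 + b) pp \<Longrightarrow> v_band (c - 1 + a) (c - 1 + b) pm \<Longrightarrow>
      v_band (c + a) (c + b) p0"
    using ev D unfolding band by simp_all
qed

section \<open>Writhe and link type under the moves of a destabilization sequence\<close>

lemma writhe_simps [simp]:
  "writhe (m, []) = 0"
  "writhe (m, (i, s) # w) = (if s then 1 else - 1) + writhe (m, w)"
  "writhe (m, u @ w) = writhe (m, u) + writhe (m, w)"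
  by (simp_all add: writhe_def)

lemma writhe_inv_word [simp]: "writhe (m, inv_word w) = - writhe (m, w)"
  by (induction w) (auto simp: inv_word_def)

lemma writhe_relation:
  "in_context braid_relation x y \<Longrightarrow> writhe (m, x) = writhe (m, y)"
  unfolding in_context_def by (auto elim!: braid_relation.cases)

lemma braid_eq_closure:
  assumes "braid_eq m x y" "1 \<le> m"
  shows "link_type (m, x) = link_type (m, y) \<and> writhe (m, x) = writhe (m, y)"
  using assms(1) unfolding braid_eq_def
proof (induction rule: equivclp_induct)
  case (step y z)
  then show ?case
    using link_type_relation assms(2) writhe_relation by metis
qed simp

lemma inv_word_braid_words [simp]: "inv_word w \<in> braid_words J \<longleftrightarrow> w \<in> braid_words J"
  by (induction w) (auto simp: inv_word_def)

lemma link_type_cancel_inverse: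
  "w @ g \<in> braid_words {1..<m} \<Longrightarrow> 1 \<le> m \<Longrightarrow>
    link_type (m, w @ inv_word g @ g) = link_type (m, w)"
proof (induction g)
  case (Cons x g)
  obtain i s where x: "x = (i, s)" by fastforce
  have "in_context braid_relation ((w @ inv_word g) @ [(i, \<not> s), (i, s)] @ g) ((w @ inv_word g) @ [] @ g)"
    using braid_relation.cancel[of i "\<not> s"] by (intro in_contextI) simp
  then have "link_type (m, (w @ inv_word g) @ [(i, \<not> s), (i, s)] @ g) = link_type (m, (w @ inv_word g) @ [] @ g)"
    using Cons.prems x by (intro link_type_relation) auto
  moreover have "inv_word (x # g) = inv_word g @ [(i, \<not> s)]"
    by (simp add: inv_word_def x)
  ultimately show ?case
    using Cons x by simp
qed (simp add: inv_word_def)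

lemma braid_isotopy_invariant:
  assumes "braid_isotopy K K'" "is_closed_braid K"
  shows "is_closed_braid K' \<and> strands K' = strands K \<and> writhe K' = writhe K \<and>
    link_type K' = link_type K"
  using assms(1)
proof cases
  case (1 w m g w')
  with assms(2) have m: "1 \<le> m" by (simp add: is_closed_braid_def)
  have "link_type (m, g @ w @ inv_word g) = link_type (m, w @ inv_word g @ g)"
    using link_type_rotate[of g "w @ inv_word g" m] 1 by auto
  also have "\<dots> = link_type (m, w)"
    using link_type_cancel_inverse[of w g m] m 1 by auto
  finally show ?thesis
    using braid_eq_closure[OF 1(6) m] 1 m by (auto simp: is_closed_braid_def)
qed

lemma exchange_move_invariant:
  assumes "exchange_move K K'" "is_closed_braid K"
  shows "is_closed_braid K' \<and> strands K' = strands K \<and> writhe K' = writhe K \<and>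
    link_type K' = link_type K"
  using assms by cases (auto simp: is_closed_braid_def)

lemma destabilization_invariant:
  assumes "destabilization s K K'"
  shows "is_closed_braid K' \<and> int (strands K') = int (strands K) - 1 \<and>
    writhe K' = writhe K - (if s then 1 else - 1) \<and> link_type K' = link_type K"
  using assms
proof cases
  case (1 m x)
  then show ?thesis
    using link_type_destab[of x "m - 1" s] by (auto simp: is_closed_braid_def writhe_def)
qed

text \<open>Up to constants, \<open>writhe + strands\<close> and \<open>writhe - strands\<close> are
  the two MFW bounds. The inequalities absorb the uncounted destabilizations, which fix the counted
  bound and move the other one inwards.\<close>

lemma destab_sequence_invariant:
  assumes "destab_sequence s q K K'" "is_closed_braid K"
  shows "is_closed_braid K' \<and> link_type K' = link_type K \<and>
    writhe K' + int (strands K') + (if s then 2 * int q else 0) \<le> writhe K + int (strands K) \<and>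
    writhe K - int (strands K) + (if s then 0 else 2 * int q) \<le> writhe K' - int (strands K')"
  using assms
proof (induction rule: destab_sequence.induct)
  case (isotopy s q K K' K'')
  then show ?case using braid_isotopy_invariant[of K' K''] by simp
next
  case (exchange s q K K' K'')
  then show ?case using exchange_move_invariant[of K' K''] by simp
next
  case (destab s q K K' K'')
  then show ?case using destabilization_invariant[of s K' K''] by (simp split: if_splits)
next
  case (destab_other s q K K' K'')
  then show ?case using destabilization_invariant[of "\<not> s" K' K''] by (simp split: if_splits)
qed simp

section \<open>The Morton--Franks--Williams inequality\<close>

lemma commute_past_word:
  assumes comm: "\<And>A B i j. i + 1 < j \<Longrightarrow> Q (A @ [i, j] @ B) \<longleftrightarrow> Q (A @ [j, i] @ B)"
    and "\<And>j. j \<in> set y \<Longrightarrow> j + 1 < k"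
  shows "Q (A @ k # y @ B) \<longleftrightarrow> Q (A @ y @ k # B)"
  using assms(2)
proof (induction y arbitrary: A)
  case (Cons j y)
  have "Q (A @ [k, j] @ y @ B) \<longleftrightarrow> Q (A @ [j, k] @ y @ B)"
    using comm[of j k A "y @ B"] Cons.prems by auto
  moreover have "Q ((A @ [j]) @ k # y @ B) \<longleftrightarrow> Q ((A @ [j]) @ y @ k # B)"
    by (intro Cons) (use Cons.prems in auto)
  ultimately show ?case by simp
qed simp

text \<open>Between two neighbouring top letters, the word may be assumed to contain at most one letter
  \<open>k - 1\<close>: then a braid relation removes a top letter or two top letters become adjacent.\<close>

lemma few_top_letters:
  fixes Q :: "nat list \<Rightarrow> bool"
  assumes comm: "\<And>A B i j. i + 1 < j \<Longrightarrow> Q (A @ [i, j] @ B) \<longleftrightarrow> Q (A @ [j, i] @ B)"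
    and braid: "\<And>A B i. Q (A @ [i, i + 1, i] @ B) \<longleftrightarrow> Q (A @ [i + 1, i, i + 1] @ B)"
    and square: "\<And>A B i. Q (A @ [i, i] @ B)"
  shows "set x \<subseteq> {1..k} \<Longrightarrow>
    (\<And>y. set y \<subseteq> {1..k} \<Longrightarrow> count_list y k \<le> 1 \<Longrightarrow> Q (A @ y @ B)) \<Longrightarrow> Q (A @ x @ B)"
proof (induction k arbitrary: x A B)
  case (Suc k)
  let ?K = "Suc k"
  from Suc.prems(1) show ?case
  proof (induction "count_list x ?K" arbitrary: x rule: less_induct)
    case less
    show ?case
    proof (cases "count_list x ?K \<le> 1")
      case False
      then have "?K \<in> set x"
        using count_list_0_iff[of x ?K] by auto
      then obtain x0 r where x: "x = x0 @ ?K # r" "?K \<notin> set x0"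
        by (meson split_list_first)
      then have "?K \<in> set r"
        using False x count_notin[of ?K x0] count_notin[of ?K r] by (cases "?K \<in> set r") auto
      then obtain x1 x2 where r: "r = x1 @ ?K # x2" "?K \<notin> set x1"
        by (meson split_list_first)
      have x1: "set x1 \<subseteq> {1..k}"
        using less.prems x r by (fastforce simp: le_Suc_eq)
      have "Q ((A @ x0 @ [?K]) @ y @ (?K # x2 @ B))"
        if y: "set y \<subseteq> {1..k}" "count_list y k \<le> 1" for y
      proof (cases "k \<in> set y")
        case True
        then obtain y1 y2 where y12: "y = y1 @ k # y2" "k \<notin> set y1"
          by (meson split_list_first)
        with y(2) have "k \<notin> set y2"
          using count_list_0_iff[of y2 k] by simp
        with y12 y(1) have far: "j + 1 < ?K" if "j \<in> set y1 \<union> set y2" for j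
          using that by (cases "j = k") (auto simp: subset_iff less_le)
        have past: "Q (A' @ ?K # z @ B') \<longleftrightarrow> Q (A' @ z @ ?K # B')"
          if "\<And>j. j \<in> set z \<Longrightarrow> j + 1 < ?K" for A' z B'
          by (rule commute_past_word) (rule comm, assumption, rule that)
        \<comment> \<open>Both letters \<open>?K\<close> commute past \<open>y1\<close> and
          \<open>y2\<close> to form \<open>?K k ?K\<close>, which the braid relation trades for
          \<open>k ?K k\<close>, with one top letter fewer.\<close>
        let ?x = "x0 @ y1 @ [k, ?K, k] @ y2 @ x2"
        have "Q (A @ ?x @ B)"
        proof (rule less.hyps)
          have "count_list y1 ?K = 0" "count_list y2 ?K = 0" "count_list x1 ?K = 0"
            using far r by (fastforce simp: count_list_0_iff)+
          then show "count_list ?x ?K < count_list x ?K"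
            by (simp add: x r)
          show "set ?x \<subseteq> {1..?K}"
            using less.prems y y12 by (auto simp: x r subset_iff)
        qed
        then have "Q ((A @ x0 @ y1) @ [?K, k, ?K] @ y2 @ x2 @ B)"
          using braid[of "A @ x0 @ y1" k "y2 @ x2 @ B"] by simp
        then have "Q ((A @ x0 @ y1 @ [?K, k]) @ y2 @ ?K # x2 @ B)"
          using past[of y2 "A @ x0 @ y1 @ [?K, k]" "x2 @ B"] far by simp
        then have "Q ((A @ x0) @ ?K # y1 @ (k # y2 @ ?K # x2 @ B))"
          using past[of y1 "A @ x0" "k # y2 @ ?K # x2 @ B"] far by simp
        then show ?thesis by (simp add: y12)
      next
        case False
        have "Q ((A @ x0) @ ?K # y @ (?K # x2 @ B)) \<longleftrightarrow> Q ((A @ x0) @ y @ ?K # (?K # x2 @ B))"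
        proof (rule commute_past_word)
          show "j + 1 < ?K" if "j \<in> set y" for j
            using False that y(1) by (cases "j = k") (auto simp: subset_iff less_le)
        qed (rule comm)
        then show ?thesis
          using square[of "A @ x0 @ y" ?K "x2 @ B"] by simp
      qed
      then have "Q ((A @ x0 @ [?K]) @ x1 @ (?K # x2 @ B))"
        by (rule Suc.IH[OF x1])
      then show ?thesis by (simp add: x r)
    qed (use less.prems Suc.prems(2) in blast)
  qed
qed simp

text \<open>A band relative to the writhe: the skein relation respects it, with the same \<open>a\<close> and \<open>b\<close> for
  all three closed braids.\<close>

definition in_band :: "(link \<Rightarrow> laurent) \<Rightarrow> int \<Rightarrow> int \<Rightarrow> closed_braid \<Rightarrow> bool" where
  "in_band P a b K \<longleftrightarrow> v_band (writhe K + a) (writhe K + b) (P (link_type K))"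

lemma in_band_cong:
  "link_type K = link_type K' \<Longrightarrow> writhe K = writhe K' \<Longrightarrow> in_band P a b K \<longleftrightarrow> in_band P a b K'"
  by (simp add: in_band_def)

text \<open>All braid strands point upwards, so every site is of the \<open>parallel\<close> kind
  and its resolution just deletes the letter.\<close>

lemma in_band_site:
  assumes P: "is_homflypt P"
    and w: "u \<in> braid_words {1..<m}" "w \<in> braid_words {1..<m}" "i \<in> {1..<m}"
    and "distinct [\<alpha>, \<beta>, \<gamma>]"
    and "in_band P a b (at_site m u i w \<beta>)" "in_band P a b (at_site m u i w \<gamma>)"
  shows "in_band P a b (at_site m u i w \<alpha>)"
proof -
  let ?A = "cups 0 m @ crossings u" and ?B = "crossings w @ caps 0 m" and ?K = "at_site m u i w"
  have "link_diagram (braid_closure (?K Plus))"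
    using w by (intro link_diagram_closure) (auto simp: is_closed_braid_def at_site_def)
  then have "link_diagram (?A @ [(i - 1, Cross True)] @ ?B)"
    by (simp add: braid_closure_eq at_site_def)
  moreover have "run ?A [] = Some (braid_level m)"
    by (simp add: run_append run_cups run_crossings[OF w(1)])
  ultimately have "skein_triple (?A @ [(i - 1, Cross True)] @ ?B) (?A @ [(i - 1, Cross False)] @ ?B) (?A @ ?B)"
    using w(3) by (intro skein_triple.parallel[where st = "braid_level m"]) (auto simp: nth_append)
  then have "skein_triple (braid_closure (?K Plus)) (braid_closure (?K Minus)) (braid_closure (?K Zero))"
    by (simp add: braid_closure_eq at_site_def)
  then have skein: "mono_vz (-1) 0 * P (link_type (?K Plus)) - mono_vz 1 0 * P (link_type (?K Minus))
      = mono_vz 0 1 * P (link_type (?K Zero))"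
    using P unfolding is_homflypt_def link_type_def by blast
  let ?c = "writhe (?K Zero)"
  have "writhe (?K Plus) = ?c + 1" "writhe (?K Minus) = ?c - 1"
    by (simp_all add: at_site_def)
  then have "in_band P a b (?K Plus) \<longleftrightarrow> v_band (?c + 1 + a) (?c + 1 + b) (P (link_type (?K Plus)))"
    and "in_band P a b (?K Minus) \<longleftrightarrow> v_band (?c - 1 + a) (?c - 1 + b) (P (link_type (?K Minus)))"
    and "in_band P a b (?K Zero) \<longleftrightarrow> v_band (?c + a) (?c + b) (P (link_type (?K Zero)))"
    by (simp_all only: in_band_def)
  note third = v_band_skein[OF skein, of ?c a b, folded this]
  show ?thesis
    using assms(5-) by - (cases \<alpha>; cases \<beta>; cases \<gamma>; simp; rule third; assumption)
qed

lemma in_band_flip: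
  assumes "is_homflypt P" "u @ (i, s) # w \<in> braid_words {1..<m}"
    and "in_band P a b (m, u @ w)" "in_band P a b (m, u @ (i, \<not> s) # w)"
  shows "in_band P a b (m, u @ (i, s) # w)"
proof (cases s)
  case True
  with assms show ?thesis
    using in_band_site[OF assms(1), of u m w i Plus Zero Minus] by (simp add: at_site_def)
next
  case False
  with assms show ?thesis
    using in_band_site[OF assms(1), of u m w i Minus Zero Plus] by (simp add: at_site_def)
qed

text \<open>Flipping one letter costs only the resolved word, which is shorter and thus covered by
  \<open>short\<close>. The prefix \<open>u\<close> collects the letters already adjusted.\<close>

lemma in_band_change_signs:
  assumes P: "is_homflypt P"
    and short: "\<And>x. x \<in> braid_words {1..<m} \<Longrightarrow> length x < length (u @ w) \<Longrightarrow> in_band P a b (m, x)"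
    and "map fst w = map fst w'" "u @ w \<in> braid_words {1..<m}" "in_band P a b (m, u @ w)"
  shows "in_band P a b (m, u @ w')"
  using assms(2-)
proof (induction w arbitrary: u w')
  case (Cons x w)
  obtain i s t v where x: "x = (i, s)" and w': "w' = (i, t) # v" and v: "map fst w = map fst v"
    using Cons.prems(2) by (cases x; cases w') auto
  have W: "i \<in> {1..<m}" "u \<in> braid_words {1..<m}" "w \<in> braid_words {1..<m}"
    using Cons.prems(3) by (simp_all add: x)
  have short: "in_band P a b (m, y)"
    if "y \<in> braid_words {1..<m}" "length y \<le> length u + length w" for y
    using Cons.prems(1)[OF that(1)] that(2) by simp
  have "in_band P a b (m, u @ (i, t) # w)"
  proof (cases "s = t")
    case False
    then have "(i, \<not> t) = x" by (auto simp: x)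
    moreover have "in_band P a b (m, u @ w)"
      by (rule short) (use W in simp_all)
    moreover have "u @ (i, t) # w \<in> braid_words {1..<m}"
      using W by simp
    ultimately show ?thesis
      using Cons.prems(4) by - (rule in_band_flip[OF P], simp_all)
  qed (use Cons.prems(4) x in simp)
  with W v have "in_band P a b (m, (u @ [(i, t)]) @ v)"
    by - (rule Cons.IH, simp_all add: short)
  then show ?case by (simp add: w')
qed simp

text \<open>The extra letter changes the writhe by 1 in either direction; widening the band by 1 at
  both ends absorbs this for both signs.\<close>

lemma in_band_stabilize:
  assumes "in_band P (1 - int k) (int k - 1) (k, x)" "x \<in> braid_words {1..<k}" "1 \<le> k"
  shows "in_band P (- int k) (int k) (Suc k, x @ [(k, s)])"
proof -
  have "link_type (Suc k, x @ [(k, s)]) = link_type (k, x)"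
    by (rule link_type_destab[OF assms(2,3)])
  moreover have "writhe (Suc k, x) = writhe (k, x)"
    by (simp add: writhe_def)
  ultimately show ?thesis
    using v_band_mono[OF assms(1)[unfolded in_band_def]] by (simp add: in_band_def)
qed

lemma braid_words_mono: "x \<in> braid_words J \<Longrightarrow> J \<subseteq> J' \<Longrightarrow> x \<in> braid_words J'"
  by (induction x) (auto simp: split_paired_all)

text \<open>Modulo shorter words, the skein relation makes signs irrelevant and kills squares of generators.
  What remains are words with at most one letter \<open>\<sigma>\<^sub>k\<close>. With one such letter the closed braid is a
  stabilization; with none it is the member \<open>K\<^sub>0\<close> of a skein triple whose other two members are.\<close>

lemma Morton_Franks_Williams_step:
  assumes P: "is_homflypt P" and k: "1 \<le> k"
    and IH: "\<And>x. x \<in> braid_words {1..<k} \<Longrightarrow> in_band P (1 - int k) (int k - 1) (k, x)"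
    and "w \<in> braid_words {1..<Suc k}"
  shows "in_band P (- int k) (int k) (Suc k, w)"
  using assms(4)
proof (induction "length w" arbitrary: w rule: less_induct)
  case less
  let ?W = "braid_words {1..<Suc k}"
  let ?G = "\<lambda>x. in_band P (- int k) (int k) (Suc k, x)"
  \<comment> \<open>Signs being irrelevant modulo shorter words, only index lists matter;
    \<open>lift\<close> represents each by its positive word.\<close>
  define lift where "lift = map (\<lambda>i::nat. (i, True))"
  have lift: "lift [] = []" "lift (i # l) = (i, True) # lift l" "lift (l @ l') = lift l @ lift l'"
    "length (lift l) = length l" "map fst (lift l) = l" for i l l'
    by (auto simp: lift_def o_def)
  have lift_W: "lift l \<in> braid_words {1..<Suc m} \<longleftrightarrow> set l \<subseteq> {1..m}" for l m
    by (auto simp: lift_def braid_words_def less_Suc_eq_le)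
  have relation: "?G x \<longleftrightarrow> ?G y" if "in_context braid_relation x y" "x \<in> ?W" for x y
    using that link_type_relation[of x y "Suc k"] writhe_relation[of x y] by (intro in_band_cong) auto
  \<comment> \<open>The guard makes \<open>Q\<close> trivially true outside the words in reach of
    the induction hypothesis, so the closure properties can be claimed for all contexts. The two
    relations used preserve length and letters.\<close>
  define Q where "Q l \<longleftrightarrow> (set l \<subseteq> {1..k} \<and> length l = length w \<longrightarrow> ?G (lift l))" for l
  have Q_relation: "Q (A @ l @ B) \<longleftrightarrow> Q (A @ r @ B)"
    if "braid_relation (lift l) (lift r)" "set l = set r" "length l = length r" for A B l r
    using that relation[of "lift (A @ l @ B)" "lift (A @ r @ B)"] lift_W[of "A @ l @ B" k]
      in_contextI[of braid_relation "lift l" "lift r" "lift A" "lift B"]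
    by (simp add: Q_def lift(3))
  have "Q ([] @ map fst w @ [])"
  proof (rule few_top_letters[of Q "map fst w" k])
    show "Q (A @ [i, j] @ B) \<longleftrightarrow> Q (A @ [j, i] @ B)" if "i + 1 < j" for A B i j
      using braid_relation.commute[OF that] by (intro Q_relation) (auto simp: lift)
    show "Q (A @ [i, i + 1, i] @ B) \<longleftrightarrow> Q (A @ [i + 1, i, i + 1] @ B)" for A B i
      using braid_relation.braid[of i] by (intro Q_relation) (auto simp: lift)
    show "Q (A @ [i, i] @ B)" for A B i
      unfolding Q_def
    proof
      assume l: "set (A @ [i, i] @ B) \<subseteq> {1..k} \<and> length (A @ [i, i] @ B) = length w"
      then have AB: "lift A \<in> ?W" "lift B \<in> ?W" "i \<in> {1..<Suc k}"
        using lift_W[of A k] lift_W[of B k] by auto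
      \<comment> \<open>Skein triple at the second \<open>i\<close>: the negative member cancels to
        \<open>lift A @ lift B\<close>, and the resolution is shorter by one letter.\<close>
      then have "?G (lift A @ lift B)"
        using l by (intro less.hyps) (auto simp: lift)
      then have "?G (lift A @ [(i, True), (i, False)] @ lift B)"
        using relation[of "lift A @ [(i, True), (i, False)] @ lift B" "lift A @ [] @ lift B"]
          in_contextI[of braid_relation, OF braid_relation.cancel[of i True], of "lift A" "lift B"] AB
        by auto
      moreover have "?G (lift A @ [(i, True)] @ lift B)"
        using AB l by (intro less.hyps) (auto simp: lift)
      ultimately show "?G (lift (A @ [i, i] @ B))"
        using in_band_flip[OF P, of "lift A @ [(i, True)]" i True "lift B" "Suc k"] AB
        by (auto simp: lift)
    qed
    show "set (map fst w) \<subseteq> {1..k}"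
      using less.prems by (auto simp: braid_words_def)
    fix y :: "nat list"
    assume y: "set y \<subseteq> {1..k}" "count_list y k \<le> 1"
    have "?G (lift y)"
    proof (cases "k \<in> set y")
      case True
      then obtain y1 y2 where y12: "y = y1 @ k # y2" "k \<notin> set y1"
        by (meson split_list_first)
      with y(2) have "k \<notin> set y2"
        using count_list_0_iff[of y2 k] by simp
      with y12 y(1) have x: "lift (y2 @ y1) \<in> braid_words {1..<k}"
        unfolding lift_def braid_words_def by (fastforce simp: less_le)
      have "link_type (Suc k, lift y1 @ ([(k, True)] @ lift y2))
          = link_type (Suc k, ([(k, True)] @ lift y2) @ lift y1)"
        using lift_W[of y k] y(1) by (intro link_type_rotate) (simp add: y12 lift)
      also have "\<dots> = link_type (Suc k, (lift y2 @ lift y1) @ [(k, True)])"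
        using lift_W[of y k] y(1) link_type_rotate[of "[(k, True)]" "lift y2 @ lift y1" "Suc k"]
        by (simp add: y12 lift)
      finally have "?G (lift y) \<longleftrightarrow> ?G (lift (y2 @ y1) @ [(k, True)])"
        by (intro in_band_cong) (simp_all add: y12 lift)
      then show ?thesis
        using in_band_stabilize[OF IH[OF x] x k] by blast
    next
      case False
      then have x: "lift y \<in> braid_words {1..<k}"
        using y(1) unfolding lift_def braid_words_def by (fastforce simp: less_le)
      then show ?thesis
        using in_band_site[OF P, of "lift y" "Suc k" "[]" k Zero Plus Minus "- int k" "int k"] k
          in_band_stabilize[OF IH[OF x] x k] braid_words_mono[OF x, of "{1..<Suc k}"]
        by (simp add: at_site_def)
    qed
    then show "Q ([] @ y @ [])" by (simp add: Q_def)
  qed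
  then have "?G (lift (map fst w))"
    using less.prems by (auto simp: Q_def braid_words_def)
  moreover have "lift (map fst w) \<in> ?W"
    using lift_W[of "map fst w" k] less.prems by (auto simp: braid_words_def)
  ultimately show ?case
    using in_band_change_signs[OF P, of "Suc k" "[]" "lift (map fst w)" "- int k" "int k" w]
      less.hyps lift by simp
qed

theorem Morton_Franks_Williams:
  assumes P: "is_homflypt P" and "is_closed_braid K"
  shows "in_band P (1 - int (strands K)) (int (strands K) - 1) K"
proof -
  have "in_band P (- int k) (int k) (Suc k, w)" if "w \<in> braid_words {1..<Suc k}" for k w
    using that
  proof (induction k arbitrary: w)
    case 0
    then have "w = []" by (cases w) auto
    moreover have "braid_closure (Suc 0, []) = unknot"
      by (simp add: braid_closure_def unknot_def)
    ultimately show ?case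
      using P by (simp add: in_band_def v_band_def link_type_def is_homflypt_def eval_vz_one)
  next
    case (Suc k)
    then show ?case
      using Morton_Franks_Williams_step[OF P, of "Suc k" w] by simp
  qed
  from this[of "snd K" "strands K - 1"] show ?thesis
    using assms(2) by (cases K) (auto simp: is_closed_braid_def of_nat_diff)
qed

lemma in_band_destabilizable:
  assumes P: "is_homflypt P" and K: "is_closed_braid K" and "destabilizable s p K"
  shows "in_band P (1 - int (strands K) + (if s then 0 else 2 * int p))
    (int (strands K) - 1 - (if s then 2 * int p else 0)) K"
proof -
  obtain q K' where q: "p \<le> q" "destab_sequence s q K K'"
    using assms(3) unfolding destabilizable_def by blast
  note inv = destab_sequence_invariant[OF q(2) K]
  then have "in_band P (1 - int (strands K')) (int (strands K') - 1) K'"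
    using Morton_Franks_Williams[OF P] by blast
  then show ?thesis
    unfolding in_band_def using inv q(1)
    by - (rule v_band_mono[of "writhe K' + (1 - int (strands K'))" "writhe K' + (int (strands K') - 1)"];
      simp split: if_splits)
qed

section \<open>Deficits\<close>

theorem theorem2p2:
  fixes P :: "link \<Rightarrow> laurent" and L :: link and K :: closed_braid
    and u w :: braid_word and m i p n :: nat and \<alpha> \<beta> \<gamma> :: site_sign
  assumes "is_homflypt P"
    and "is_closed_braid K" and "link_type K = L" and "strands K = braid_index L"
    and "u \<in> braid_words {1..<m}" and "w \<in> braid_words {1..<m}" and "i \<in> {1..<m}"
    and "distinct [\<alpha>, \<beta>, \<gamma>]"
    and "K = at_site m u i w \<alpha>"
  shows "(pos_destab_applicable p (at_site m u i w \<beta>) \<and>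
          pos_destab_applicable p (at_site m u i w \<gamma>) \<longrightarrow>
            deficit_plus P K \<ge> 2 * int p) \<and>
         (neg_destab_applicable n (at_site m u i w \<beta>) \<and>
          neg_destab_applicable n (at_site m u i w \<gamma>) \<longrightarrow>
            deficit_minus P K \<ge> 2 * int n) \<and>
         (pos_destab_applicable p (at_site m u i w \<beta>) \<and>
          pos_destab_applicable p (at_site m u i w \<gamma>) \<and>
          neg_destab_applicable n (at_site m u i w \<beta>) \<and>
          neg_destab_applicable n (at_site m u i w \<gamma>) \<and> p + n > 0 \<longrightarrow>
            \<not> MFW_sharp P L \<and> deficit P L > 0)"
proof -
  let ?K = "at_site m u i w"
  have m: "strands (?K \<epsilon>) = m" and closed: "is_closed_braid (?K \<epsilon>)" for \<epsilon>
    using assms(5-7) by (cases \<epsilon>; auto simp: at_site_def is_closed_braid_def)+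
  \<comment> \<open>The three closed braids at the site share the strand number \<open>m\<close>, so
    relative to the writhe both hypotheses give the same interval; \<open>s\<close> selects the end
    that is cut.\<close>
  have band: "in_band P (1 - int m + (if s then 0 else 2 * int r))
      (int m - 1 - (if s then 2 * int r else 0)) K"
    if "destabilizable s r (?K \<beta>)" "destabilizable s r (?K \<gamma>)" for s r
    using in_band_site[OF assms(1,5,6,7,8)] in_band_destabilizable[OF assms(1) closed that(1)]
      in_band_destabilizable[OF assms(1) closed that(2)]
    by (simp add: m assms(9))
  have plus: "2 * int p \<le> deficit_plus P K"
    if "pos_destab_applicable p (?K \<beta>)" "pos_destab_applicable p (?K \<gamma>)"
    using band[OF that] v_band_degrees(2) m assms(9) by (force simp: in_band_def deficit_plus_def)
  have minus: "2 * int n \<le> deficit_minus P K"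
    if "neg_destab_applicable n (?K \<beta>)" "neg_destab_applicable n (?K \<gamma>)"
    using band[OF that] v_band_degrees(1) m assms(9) by (force simp: in_band_def deficit_minus_def)
  \<comment> \<open>Minimality of the strand number enters here. The right-hand side is at least
    \<open>2 * (p + n)\<close> when both hypotheses hold.\<close>
  have "2 * deficit P L = of_int (deficit_plus P K + deficit_minus P K)"
    using assms(3,4) by (simp add: deficit_def deficit_plus_def deficit_minus_def field_simps)
  with plus minus show ?thesis
    by (auto simp: MFW_sharp_def)
qed

end
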